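(* Let $B_n(x)$ and $G_n(x)$ be the polynomials defined by $\frac{ze^{xz}}{e^z-1}=\sum_{n=0}^{\infty}\frac{B_n(x)}{n!}z^n$ and $\frac{ze^{xz}}{e^z+1}=\sum_{n=0}^{\infty}\frac{G_n(x)}{n!}z^n$. Then for every integer $n\geq 0$ and every $x$: (i) $G_n(1-x)=(-1)^{n+1}G_n(x)$. (ii) $G_n(x)=B_n(x)-2^n B_n\left(\frac{x}{2}\right)$. (iii) $G_n(x)=2^n B_n\left(\frac{x+1}{2}\right)-B_n(x)$. (iv) $B_n(x)=2^{n-1}\left[B_n\left(\frac{x+1}{2}\right)+B_n\left(\frac{x}{2}\right)\right]$.
   Context: $B_n(x)$ are the Bernoulli polynomials and $G_n(x)$ the analogous (Genocchi-type) polynomials, defined as coefficients of power series expansions at $z=0$ (equivalently, of formal power series in $z$): $$\frac{ze^{xz}}{e^z-1}=\sum_{n=0}^{\infty}\frac{B_n(x)}{n!}z^n,\qquad \frac{ze^{xz}}{e^z+1}=\sum_{n=0}^{\infty}\frac{G_n(x)}{n!}z^n.$$ Equivalently, $B_n(x)=\sum_{k=0}^{n}\binom{n}{k}B_{n-k}x^k$ and $G_n(x)=\sum_{k=0}^{n}\binom{n}{k}G_{n-k}x^k$, where $\frac{z}{e^z-1}=\sum_{n\ge 0}\frac{B_n}{n!}z^n$ and $\frac{z}{e^z+1}=\sum_{n\ge 0}\frac{G_n}{n!}z^n$. The numerator in the second generating function is $z$ (not $2z$). Here $x$ is a real variable. *)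

theory Defs
  imports "HOL-Computational_Algebra.Formal_Power_Series"
begin

text \<open>
  Both divisors below are nonzero. The first has subdegree 1, so it is not a unit, but the
  dividend has subdegree 1 as well; by the lemmas below the library's truncating division
  of formal power series is the exact quotient.
\<close>

definition bernoulli_gf :: "real \<Rightarrow> real fps" where
  "bernoulli_gf x = (fps_X * fps_exp x) / (fps_exp 1 - 1)"

definition genocchi_gf :: "real \<Rightarrow> real fps" where
  "genocchi_gf x = (fps_X * fps_exp x) / (fps_exp 1 + 1)"

definition bernoulli_poly :: "nat \<Rightarrow> real \<Rightarrow> real" where
  "bernoulli_poly n x = fact n * fps_nth (bernoulli_gf x) n"

text \<open>The numerator is z rather than 2z, so this is half of the usual Genocchi polynomial.\<close>

definition genocchi_poly :: "nat \<Rightarrow> real \<Rightarrow> real" where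
  "genocchi_poly n x = fact n * fps_nth (genocchi_gf x) n"

lemma bernoulli_gf_exact: "bernoulli_gf x * (fps_exp 1 - 1) = fps_X * fps_exp x"
proof -
  have n1: "fps_nth (fps_exp 1 - 1 :: real fps) 1 \<noteq> 0" by simp
  then have nz: "(fps_exp 1 - 1 :: real fps) \<noteq> 0" by (metis fps_zero_nth)
  have "subdegree (fps_exp 1 - 1 :: real fps) \<le> 1" using n1 by (rule subdegree_leI)
  moreover have "subdegree (fps_X * fps_exp x :: real fps) \<ge> 1"
    by (rule subdegree_geI) (auto simp: fps_eq_iff intro!: exI[of _ 1])
  ultimately have "(fps_exp 1 - 1 :: real fps) dvd fps_X * fps_exp x"
    using nz by (subst fps_dvd_iff) (auto simp: fps_eq_iff intro!: exI[of _ 1])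
  then show ?thesis unfolding bernoulli_gf_def by simp
qed

lemma genocchi_gf_exact: "genocchi_gf x * (fps_exp 1 + 1) = fps_X * fps_exp x"
proof -
  have "fps_nth (fps_exp 1 + 1 :: real fps) 0 \<noteq> 0" by simp
  then have "(fps_exp 1 + 1 :: real fps) dvd 1" by (subst fps_is_unit_iff)
  then have "(fps_exp 1 + 1 :: real fps) dvd fps_X * fps_exp x" by (rule unit_imp_dvd)
  then show ?thesis unfolding genocchi_gf_def by simp
qed

lemma bernoulli_gf_coeffs: "bernoulli_gf x = Abs_fps (\<lambda>n. bernoulli_poly n x / fact n)"
  by (simp add: fps_eq_iff bernoulli_poly_def)

lemma genocchi_gf_coeffs: "genocchi_gf x = Abs_fps (\<lambda>n. genocchi_poly n x / fact n)"
  by (simp add: fps_eq_iff genocchi_poly_def)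

end

theory Submission imports Defs begin

text \<open>
  The identities say that power series in \<open>z\<close> agree, and a factor \<open>c ^ n\<close> on the coefficients
  is the substitution of \<open>c * z\<close> for \<open>z\<close>. They are therefore checked by clearing denominators
  in the generating functions.

  With \<open>c = 2\<close> the Bernoulli series gets the denominator
  \<open>exp (2 * z) - 1 = (exp z - 1) * (exp z + 1)\<close>, a common multiple of the other two
  denominators, so the two expressions of the Genocchi series by Bernoulli series
  (\<open>genocchi_gf_eq_bernoulli_diff\<close> and \<open>genocchi_gf_eq_bernoulli_diff_shift\<close>) become identities
  between exponentials. Equating these two expressions gives the duplication formula for the
  Bernoulli polynomials.

  With \<open>c = -1\<close> the Genocchi denominator becomes \<open>exp (-z) + 1 = exp (-z) * (exp z + 1)\<close>, and
  the extra factor turns \<open>exp (-x * z)\<close> into \<open>exp ((1 - x) * z)\<close>; this is the reflection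
  formula (\<open>genocchi_gf_reflect\<close>).
\<close>

lemma bernoulli_gf_scaled_exact:
  "(bernoulli_gf x oo (fps_const c * fps_X)) * (fps_exp c - 1)
     = fps_const c * fps_X * fps_exp (c * x)"
proof -
  have "(bernoulli_gf x * (fps_exp 1 - 1)) oo (fps_const c * fps_X)
      = (fps_X * fps_exp x) oo (fps_const c * fps_X)"
    by (simp only: bernoulli_gf_exact)
  then show ?thesis
    by (simp add: fps_compose_mult_distrib fps_compose_sub_distrib)
qed

lemma genocchi_gf_scaled_exact:
  "(genocchi_gf x oo (fps_const c * fps_X)) * (fps_exp c + 1)
     = fps_const c * fps_X * fps_exp (c * x)"
proof -
  have "(genocchi_gf x * (fps_exp 1 + 1)) oo (fps_const c * fps_X)
      = (fps_X * fps_exp x) oo (fps_const c * fps_X)"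
    by (simp only: genocchi_gf_exact)
  then show ?thesis
    by (simp add: fps_compose_mult_distrib fps_compose_add_distrib)
qed

lemma fps_exp_plus_one_neq_zero: "fps_exp (c :: real) + 1 \<noteq> 0"
proof
  assume "fps_exp c + 1 = 0"
  then have "fps_nth (fps_exp c + 1) 0 = 0" by simp
  then show False by simp
qed

lemma fps_exp_two_minus_one: "fps_exp (2 :: real) - 1 = (fps_exp 1 - 1) * (fps_exp 1 + 1)"
  using fps_exp_add_mult[of "1 :: real" 1] by (simp add: algebra_simps)

text \<open>
  Multiplying the scaled equation for \<open>c = -1\<close> by \<open>fps_exp 1\<close> restores the denominator
  \<open>fps_exp 1 + 1\<close>.
\<close>

lemma genocchi_gf_reflect: "genocchi_gf (1 - x) = - (genocchi_gf x oo (fps_const (-1) * fps_X))"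
proof -
  let ?R = "genocchi_gf x oo (fps_const (-1) * fps_X)"
  have "?R * (fps_exp 1 + 1) = fps_exp 1 * (?R * (fps_exp (-1) + 1))"
    using fps_exp_add_mult[of "1 :: real" "-1"] by (simp add: algebra_simps)
  also have "\<dots> = - (fps_X * fps_exp (1 - x))"
    unfolding genocchi_gf_scaled_exact using fps_exp_add_mult[of 1 "- x"]
    by (simp add: algebra_simps flip: fps_const_neg)
  also have "\<dots> = - (genocchi_gf (1 - x) * (fps_exp 1 + 1))"
    by (simp only: genocchi_gf_exact)
  finally have "(genocchi_gf (1 - x) + ?R) * (fps_exp 1 + 1) = 0"
    by (simp add: algebra_simps)
  then show ?thesis
    using fps_exp_plus_one_neq_zero[of 1] by (simp add: eq_neg_iff_add_eq_0)
qed

text \<open>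
  Over the common denominator \<open>fps_exp 2 - 1\<close>, with the factor \<open>fps_X * fps_exp x\<close> removed, this
  is \<open>e - 1 = (e + 1) - 2\<close> for \<open>e = fps_exp 1\<close>.
\<close>

lemma genocchi_gf_eq_bernoulli_diff:
  "genocchi_gf x = bernoulli_gf x - (bernoulli_gf (x / 2) oo (fps_const 2 * fps_X))"
    (is "_ = _ - ?S")
proof -
  let ?E = "fps_exp (1 :: real)"
  have "genocchi_gf x * (fps_exp 2 - 1) = genocchi_gf x * (?E + 1) * (?E - 1)"
    by (simp add: fps_exp_two_minus_one mult_ac)
  also have "\<dots> = fps_X * fps_exp x * (?E + 1) - 2 * fps_X * fps_exp x"
    unfolding genocchi_gf_exact by (simp add: algebra_simps)
  also have "\<dots> = bernoulli_gf x * (?E - 1) * (?E + 1) - ?S * (fps_exp 2 - 1)"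
    by (simp add: bernoulli_gf_exact bernoulli_gf_scaled_exact numeral_fps_const)
  also have "\<dots> = (bernoulli_gf x - ?S) * (fps_exp 2 - 1)"
    by (simp add: fps_exp_two_minus_one algebra_simps)
  finally show ?thesis
    by simp
qed

text \<open>
  The shift of \<open>x\<close> by one contributes a factor \<open>e = fps_exp 1\<close>, and over the denominator
  \<open>fps_exp 2 - 1\<close> the claim becomes \<open>e - 1 = 2 * e - (e + 1)\<close>.
\<close>

lemma genocchi_gf_eq_bernoulli_diff_shift:
  "genocchi_gf x = (bernoulli_gf ((x + 1) / 2) oo (fps_const 2 * fps_X)) - bernoulli_gf x"
    (is "_ = ?S - _")
proof -
  let ?E = "fps_exp (1 :: real)"
  have "genocchi_gf x * (fps_exp 2 - 1) = genocchi_gf x * (?E + 1) * (?E - 1)"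
    by (simp add: fps_exp_two_minus_one mult_ac)
  also have "\<dots> = 2 * fps_X * fps_exp (x + 1) - fps_X * fps_exp x * (?E + 1)"
    unfolding genocchi_gf_exact by (simp add: fps_exp_add_mult algebra_simps)
  also have "\<dots> = ?S * (fps_exp 2 - 1) - bernoulli_gf x * (?E - 1) * (?E + 1)"
    by (simp add: bernoulli_gf_exact bernoulli_gf_scaled_exact numeral_fps_const)
  also have "\<dots> = (?S - bernoulli_gf x) * (fps_exp 2 - 1)"
    by (simp add: fps_exp_two_minus_one algebra_simps)
  finally show ?thesis
    by simp
qed

theorem mainTheorem4:
  fixes n :: nat and x :: real
  shows "genocchi_poly n (1 - x) = (-1) ^ (n + 1) * genocchi_poly n x
    \<and> genocchi_poly n x = bernoulli_poly n x - 2 ^ n * bernoulli_poly n (x / 2)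
    \<and> genocchi_poly n x = 2 ^ n * bernoulli_poly n ((x + 1) / 2) - bernoulli_poly n x
    \<and> bernoulli_poly n x =
        2 powi (int n - 1) * (bernoulli_poly n ((x + 1) / 2) + bernoulli_poly n (x / 2))"
proof -
  have reflect: "genocchi_poly n (1 - x) = (-1) ^ (n + 1) * genocchi_poly n x"
    by (simp add: genocchi_poly_def genocchi_gf_reflect)
  have diff: "genocchi_poly n x = bernoulli_poly n x - 2 ^ n * bernoulli_poly n (x / 2)"
    by (simp add: genocchi_poly_def bernoulli_poly_def genocchi_gf_eq_bernoulli_diff
        right_diff_distrib)
  have shift: "genocchi_poly n x = 2 ^ n * bernoulli_poly n ((x + 1) / 2) - bernoulli_poly n x"
    unfolding genocchi_poly_def bernoulli_poly_def
    by (subst genocchi_gf_eq_bernoulli_diff_shift) (simp add: right_diff_distrib)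
  have "2 powi (int n - 1) = (2 ^ n / 2 :: real)"
    by (simp add: power_int_diff)
  then have "bernoulli_poly n x =
      2 powi (int n - 1) * (bernoulli_poly n ((x + 1) / 2) + bernoulli_poly n (x / 2))"
    using diff shift by (simp only:) (simp add: field_simps)
  with reflect diff shift show ?thesis by blast
qed

end
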